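(* Let $L$ be a constructive involutive division on $\mathbb{M}$ and let $U\subset\mathbb{M}$ be a finite set that is finitely generated with respect to $L$. Then the number of nonmultiplicative prolongations checked in the course of the following algorithm InvolutiveCompletion applied to $U$ is invariant on (does not depend on) the choice of the completion orderings $\sqsubset$ made in the algorithm. Algorithm: Set $\tilde U:=U$. While there exist $u\in\tilde U$ and $x\in NM_L(u,\tilde U)$ such that $u\cdot x$ has no involutive divisors in $\tilde U$: choose any admissible monomial ordering $\sqsubset$ (the choice may differ from step to step) and such $u$ and $x$ with the lowest $u\cdot x$ with respect to $\sqsubset$, and set $\tilde U:=\tilde U\cup\{u\cdot x\}$. Return $\tilde U$.
   Context: $\mathbb{M}=\{x_1^{d_1}\cdots x_n^{d_n}\mid d_i\in\mathbb{Z}_{\ge 0}\}$. An admissible monomial ordering is a total ordering on $\mathbb{M}$, compatible with multiplication, in which $1$ is the smallest element. All monomial sets are finite. Involutive division: an involutive division $L$ on $\mathbb{M}$ assigns to any finite $U\subset\mathbb{M}$ and $u\in U$ a submonoid $L(u,U)$ of $\mathbb{M}$ such that: (a) if $w\in L(u,U)$ and $v\mid w$, then $v\in L(u,U)$; (b) if $u,v\in U$ and $uL(u,U)\cap vL(v,U)\neq\emptyset$, then $u\in vL(v,U)$ or $v\in uL(u,U)$; (c) if $v\in U$ and $v\in uL(u,U)$, then $L(v,U)\subseteq L(u,U)$; (d) if $V\subseteq U$, then $L(u,U)\subseteq L(u,V)$ for all $u\in V$. The set of variables lying in $L(u,U)$ is $M_L(u,U)$ (multiplicative variables), and $NM_L(u,U)$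 is the set of the remaining (nonmultiplicative) variables. For $u\in U$ write $u\mid_L w$ if $w\in uL(u,U)$; then $u$ is an involutive divisor of $w$ in $U$. Prolongations checked: a nonmultiplicative prolongation is the product $u\cdot x$ attached to a pair $(u,x)$ with $u\in\tilde U$ and $x\in NM_L(u,\tilde U)$ for the current set $\tilde U$. In the course of the algorithm every nonmultiplicative prolongation has to be checked for whether it has an involutive divisor in the current set $\tilde U$ (reducible) or not (irreducible, in which case it is added). Thus a prolongation, i.e. a pair $(u,x)$, is checked in a run of the algorithm if at some stage of the run $u\in\tilde U$ and $x\in NM_L(u,\tilde U)$; prolongations are counted as distinct pairs $(u,x)$. Cones: $C(U)=\bigcup_{u\in U}u\mathbb{M}$ and $C_L(U)=\bigcup_{u\in U}uL(u,U)$. A set $U$ is $L$-involutive if $C(U)=C_L(U)$. An $L$-completion of $U$ is a (finite) $L$-involutive set $\tilde U\supseteq U$ with $C(\tilde U)=C(U)$. $U$ is finitely generated with respect to $L$ if it has a finite $L$-completion. Continuous: $L$ is continuous if for any finite $U\subset\mathbb{M}$ and any finite sequence $u_1,\dots,u_k$ of elements of $U$ such that for every $i<k$ there is $x_j\in NM_L(u_i,U)$ with $u_{i+1}\mid_L u_i\cdot x_j$, one has $u_i\ne u_j$ for $i\ne j$. Constructive: a continuous involutive division $L$ is constructive if for any finite $U\subset\mathbb{M}$, $u\in U$, $x_i\in NM_L(u,U)$ such that $u\cdot x_i$ has no involutive divisors in $U$ and such that every $v\in U$, $x_j\in NM_L(v,U)$ with $v\cdot x_j\mid u\cdot x_i$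 and $v\cdot x_j\ne u\cdot x_i$ satisfy $v\cdot x_j\in C_L(U)$, the following holds: for all $w\in C_L(U)$, $u\cdot x_i\notin wL(w,U\cup\{w\})$. *)

theory Defs
  imports Main "HOL-Library.Multiset"
begin

text \<open>
  The monomial \<open>x\<^sub>1^d\<^sub>1 \<cdots> x\<^sub>n^d\<^sub>n\<close> is the multiset in which the variable \<open>x\<^sub>i\<close> occurs \<open>d\<^sub>i\<close> times;
  the \<open>n\<close> variables are the elements of a finite type. So the product of monomials is \<open>u + v\<close>,
  the monomial \<open>1\<close> is \<open>{#}\<close>, \<open>u \<cdot> x\<close> for a variable \<open>x\<close> is \<open>add_mset x u\<close>, the variable itself is
  \<open>{#x#}\<close>, and \<open>v\<close> divides \<open>w\<close> iff \<open>v \<subseteq># w\<close>.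
\<close>

type_synonym 'x monomial = "'x multiset"

text \<open>The relation \<open>r\<close> is the reflexive form of the ordering.\<close>

definition admissible_ordering :: "('x::finite) monomial rel \<Rightarrow> bool" where
  "admissible_ordering r \<longleftrightarrow>
     linear_order r \<and>
     (\<forall>m. ({#}, m) \<in> r) \<and>
     (\<forall>u v w. (u, v) \<in> r \<longrightarrow> (u + w, v + w) \<in> r)"

text \<open>The set \<open>L(u,U)\<close> is \<open>L u U\<close>; its values are relevant only for finite \<open>U\<close> and \<open>u \<in> U\<close>.\<close>

type_synonym 'x division = "'x monomial \<Rightarrow> 'x monomial set \<Rightarrow> 'x monomial set"

definition inv_multiples :: "('x::finite) division \<Rightarrow> 'x monomial \<Rightarrow> 'x monomial set \<Rightarrow> 'x monomial set" where
  "inv_multiples L u U = {u + w | w. w \<in> L u U}"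

definition inv_dvd :: "('x::finite) division \<Rightarrow> 'x monomial set \<Rightarrow> 'x monomial \<Rightarrow> 'x monomial \<Rightarrow> bool" where
  "inv_dvd L U u w \<longleftrightarrow> w \<in> inv_multiples L u U"

locale involutive_division =
  fixes L :: "('x::finite) division"
  assumes one_mem: "\<lbrakk>finite U; u \<in> U\<rbrakk> \<Longrightarrow> {#} \<in> L u U"
    and mult_mem: "\<lbrakk>finite U; u \<in> U; v \<in> L u U; w \<in> L u U\<rbrakk> \<Longrightarrow> v + w \<in> L u U"
    and divisor_mem: "\<lbrakk>finite U; u \<in> U; w \<in> L u U; v \<subseteq># w\<rbrakk> \<Longrightarrow> v \<in> L u U"
    and disjoint_or_dvd: "\<lbrakk>finite U; u \<in> U; v \<in> U; inv_multiples L u U \<inter> inv_multiples L v U \<noteq> {}\<rbrakk>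
          \<Longrightarrow> u \<in> inv_multiples L v U \<or> v \<in> inv_multiples L u U"
    and inv_dvd_subset: "\<lbrakk>finite U; u \<in> U; v \<in> U; v \<in> inv_multiples L u U\<rbrakk> \<Longrightarrow> L v U \<subseteq> L u U"
    and antimono: "\<lbrakk>finite U; V \<subseteq> U; u \<in> V\<rbrakk> \<Longrightarrow> L u U \<subseteq> L u V"

definition mult_vars :: "('x::finite) division \<Rightarrow> 'x monomial \<Rightarrow> 'x monomial set \<Rightarrow> 'x set" where
  "mult_vars L u U = {x. {#x#} \<in> L u U}"

definition nonmult_vars :: "('x::finite) division \<Rightarrow> 'x monomial \<Rightarrow> 'x monomial set \<Rightarrow> 'x set" where
  "nonmult_vars L u U = - mult_vars L u U"

definition cone :: "('x::finite) monomial set \<Rightarrow> 'x monomial set" where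
  "cone U = (\<Union>u\<in>U. {u + w | w. True})"

definition inv_cone :: "('x::finite) division \<Rightarrow> 'x monomial set \<Rightarrow> 'x monomial set" where
  "inv_cone L U = (\<Union>u\<in>U. inv_multiples L u U)"

definition involutive_set :: "('x::finite) division \<Rightarrow> 'x monomial set \<Rightarrow> bool" where
  "involutive_set L U \<longleftrightarrow> cone U = inv_cone L U"

definition is_completion :: "('x::finite) division \<Rightarrow> 'x monomial set \<Rightarrow> 'x monomial set \<Rightarrow> bool" where
  "is_completion L U V \<longleftrightarrow> finite V \<and> involutive_set L V \<and> U \<subseteq> V \<and> cone V = cone U"

definition finitely_generated :: "('x::finite) division \<Rightarrow> 'x monomial set \<Rightarrow> bool" where
  "finitely_generated L U \<longleftrightarrow> (\<exists>V. is_completion L U V)"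

definition irreducible_prolongation ::
    "('x::finite) division \<Rightarrow> 'x monomial set \<Rightarrow> 'x monomial \<Rightarrow> 'x \<Rightarrow> bool" where
  "irreducible_prolongation L U u x \<longleftrightarrow>
     u \<in> U \<and> x \<in> nonmult_vars L u U \<and> \<not> (\<exists>v\<in>U. inv_dvd L U v (add_mset x u))"

locale continuous_division = involutive_division L
  for L :: "('x::finite) division" +
  assumes continuous: "\<lbrakk>finite U; set us \<subseteq> U;
      \<forall>i. Suc i < length us \<longrightarrow>
        (\<exists>x \<in> nonmult_vars L (us ! i) U. inv_dvd L U (us ! Suc i) (add_mset x (us ! i)))\<rbrakk>
      \<Longrightarrow> distinct us"

locale constructive_division = continuous_division L
  for L :: "('x::finite) division" +
  assumes constructive: "\<lbrakk>finite U; irreducible_prolongation L U u x;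
      \<forall>v \<in> U. \<forall>y \<in> nonmult_vars L v U.
        add_mset y v \<subseteq># add_mset x u \<and> add_mset y v \<noteq> add_mset x u \<longrightarrow>
        add_mset y v \<in> inv_cone L U;
      w \<in> inv_cone L U\<rbrakk>
      \<Longrightarrow> add_mset x u \<notin> inv_multiples L w (insert w U)"

text \<open>One pass through the loop, for an arbitrary choice of the completion ordering.\<close>

definition completion_step :: "('x::finite) division \<Rightarrow> 'x monomial set \<Rightarrow> 'x monomial set \<Rightarrow> bool" where
  "completion_step L V W \<longleftrightarrow>
     (\<exists>r u x. admissible_ordering r \<and> irreducible_prolongation L V u x \<and>
        (\<forall>v y. irreducible_prolongation L V v y \<longrightarrow> (add_mset x u, add_mset y v) \<in> r) \<and>
        W = insert (add_mset x u) V)"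

text \<open>
  \<open>R i\<close> is the current set after \<open>i\<close> passes. If the loop ends, the sequence stays constant at the
  returned set; a nonterminating execution would be a sequence that never becomes constant.
\<close>

definition completion_run ::
    "('x::finite) division \<Rightarrow> 'x monomial set \<Rightarrow> (nat \<Rightarrow> 'x monomial set) \<Rightarrow> bool" where
  "completion_run L U R \<longleftrightarrow>
     R 0 = U \<and>
     (\<forall>i. if \<exists>u x. irreducible_prolongation L (R i) u x
          then completion_step L (R i) (R (Suc i))
          else R (Suc i) = R i)"

definition checked_prolongations ::
    "('x::finite) division \<Rightarrow> (nat \<Rightarrow> 'x monomial set) \<Rightarrow> ('x monomial \<times> 'x) set" where
  "checked_prolongations L R = {(u, x). \<exists>i. u \<in> R i \<and> x \<in> nonmult_vars L u (R i)}"

end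

theory Submission
  imports Defs
begin

text \<open>
  Every run of the algorithm ends, and it ends at the same set: the least \<open>L\<close>-completion of \<open>U\<close>
  with respect to inclusion. Since \<open>L(u,\<cdot>)\<close> shrinks while the current set grows, a prolongation once
  nonmultiplicative remains so. Hence the prolongations checked in a run are exactly the
  nonmultiplicative prolongations of the returned set, and the two runs even check the same pairs.

  The key is that a run never leaves an arbitrary completion \<open>V\<close> of \<open>U\<close>
  (\<open>completion_step_subset_completion\<close>). Let the current set \<open>W \<subseteq> V\<close> be extended by \<open>u \<cdot> x\<close>, and suppose
  \<open>u \<cdot> x \<notin> V\<close>. Then \<open>u \<cdot> x\<close> has an involutive divisor \<open>w\<close> in \<open>V\<close>, and \<open>w\<close> is a proper divisor. An
  admissible ordering refines divisibility, so the minimality of \<open>u \<cdot> x\<close> makes all nonmultiplicative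
  prolongations that properly divide \<open>u \<cdot> x\<close> reducible, whatever the ordering is. By continuity the
  local condition below \<open>w\<close> suffices for \<open>w \<in> C\<^sub>L(W)\<close> (\<open>inv_cone_if_prolongations_below\<close>). As
  \<open>W \<union> {w} \<subseteq> V\<close>, the monomial \<open>w\<close> also divides \<open>u \<cdot> x\<close> involutively in \<open>W \<union> {w}\<close>, which constructivity
  forbids.

  A finite completion thus bounds the strictly increasing sets of a run, so the run ends. The
  returned set has no irreducible prolongation, so by continuity again it is itself a completion.
\<close>

section \<open>Involutive divisors and nonmultiplicative variables\<close>

lemma cone_iff: "w \<in> cone U \<longleftrightarrow> (\<exists>u\<in>U. u \<subseteq># w)"
  unfolding cone_def by (auto simp: subset_mset.le_iff_add)

lemma inv_cone_iff: "w \<in> inv_cone L U \<longleftrightarrow> (\<exists>u\<in>U. inv_dvd L U u w)"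
  unfolding inv_cone_def inv_dvd_def by auto

lemma inv_dvd_imp_subseteq_mset: "inv_dvd L U u w \<Longrightarrow> u \<subseteq># w"
  unfolding inv_dvd_def inv_multiples_def by auto

lemma admissible_ordering_subseteq_mset:
  assumes "admissible_ordering r" "u \<subseteq># v"
  shows "(u, v) \<in> r"
proof -
  obtain m where m: "v = u + m"
    using assms(2) by (auto simp: subset_mset.le_iff_add)
  have "({#} + u, m + u) \<in> r"
    using assms(1) unfolding admissible_ordering_def by blast
  then show ?thesis
    by (simp add: m add.commute)
qed

context involutive_division
begin

lemma inv_dvd_self: "\<lbrakk>finite U; u \<in> U\<rbrakk> \<Longrightarrow> inv_dvd L U u u"
  unfolding inv_dvd_def inv_multiples_def using one_mem by force

lemma inv_dvd_antimono:
  "\<lbrakk>finite U; V \<subseteq> U; u \<in> V; inv_dvd L U u w\<rbrakk> \<Longrightarrow> inv_dvd L V u w"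
  unfolding inv_dvd_def inv_multiples_def using antimono by blast

lemma nonmult_vars_mono:
  "\<lbrakk>finite U; V \<subseteq> U; u \<in> V\<rbrakk> \<Longrightarrow> nonmult_vars L u V \<subseteq> nonmult_vars L u U"
  unfolding nonmult_vars_def mult_vars_def using antimono by blast

lemma mem_if_mult_vars:
  assumes "finite U" "u \<in> U" "set_mset m \<subseteq> mult_vars L u U"
  shows "m \<in> L u U"
  using assms(3)
proof (induction m)
  case empty
  then show ?case using one_mem assms by blast
next
  case (add x m)
  then have "{#x#} \<in> L u U" "m \<in> L u U"
    by (auto simp: mult_vars_def)
  then have "{#x#} + m \<in> L u U"
    using mult_mem assms by blast
  then show ?case by simp
qed

lemma nonmult_prolongation_dvd:
  assumes "finite U" "u \<in> U" "u \<subseteq># w" "\<not> inv_dvd L U u w"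
  obtains x where "x \<in> nonmult_vars L u U" "add_mset x u \<subseteq># w"
proof -
  obtain m where m: "w = u + m"
    using assms(3) by (auto simp: subset_mset.le_iff_add)
  have "m \<notin> L u U"
    using assms(4) m unfolding inv_dvd_def inv_multiples_def by blast
  then obtain x where x: "x \<in># m" "x \<in> nonmult_vars L u U"
    using mem_if_mult_vars[OF assms(1,2)] unfolding nonmult_vars_def by blast
  have "add_mset x u \<subseteq># w"
    using m x(1) by (metis add_mset_add_single mset_subset_eq_mono_add_left_cancel single_subset_iff)
  with x(2) show thesis by (rule that)
qed

end

section \<open>Local involutivity\<close>

context continuous_division
begin

text \<open>
  Starting from a divisor of \<open>w\<close> in \<open>U\<close> that is not an involutive one, multiply by a nonmultiplicative
  variable without leaving the divisors of \<open>w\<close>, pass to an involutive divisor of the product, and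
  repeat. Continuity forbids repetitions, so in the finite set \<open>U\<close> this must stop, which it can do
  only at an involutive divisor of \<open>w\<close>. Only prolongations dividing \<open>w\<close> occur; the local form
  of the hypothesis is what the minimal choice in a step of the algorithm provides.
\<close>

lemma inv_cone_if_prolongations_below:
  assumes fin: "finite U" and w: "w \<in> cone U"
    and below: "\<And>v y. \<lbrakk>v \<in> U; y \<in> nonmult_vars L v U; add_mset y v \<subseteq># w\<rbrakk>
                  \<Longrightarrow> add_mset y v \<in> inv_cone L U"
  shows "w \<in> inv_cone L U"
proof (rule ccontr)
  assume not_in: "w \<notin> inv_cone L U"
  let ?D = "{v \<in> U. v \<subseteq># w}"
  obtain v0 where v0: "v0 \<in> ?D"
    using w cone_iff by blast
  have "\<exists>v' \<in> ?D. \<exists>x \<in> nonmult_vars L v U. inv_dvd L U v' (add_mset x v)" if v: "v \<in> ?D" for v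
  proof -
    have "\<not> inv_dvd L U v w"
      using not_in v inv_cone_iff by blast
    then obtain x where x: "x \<in> nonmult_vars L v U" "add_mset x v \<subseteq># w"
      using nonmult_prolongation_dvd[OF fin, of v w] v by blast
    then obtain v' where v': "v' \<in> U" "inv_dvd L U v' (add_mset x v)"
      using below v inv_cone_iff by blast
    then have "v' \<subseteq># w"
      using inv_dvd_imp_subseteq_mset x(2) subset_mset.order_trans by blast
    with v' x(1) show ?thesis by blast
  qed
  then obtain f where f: "\<And>v. v \<in> ?D \<Longrightarrow> f v \<in> ?D \<and>
      (\<exists>x \<in> nonmult_vars L v U. inv_dvd L U (f v) (add_mset x v))"
    by metis
  have iter: "(f ^^ i) v0 \<in> ?D" for i
    by (induction i) (use v0 f in auto)
  \<comment> \<open>The chain has one element more than \<open>U\<close>, so it cannot be free of repetitions.\<close>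
  define us where "us = map (\<lambda>i. (f ^^ i) v0) [0..<Suc (card U)]"
  have sub: "set us \<subseteq> U"
    using iter by (auto simp: us_def)
  have "distinct us"
  proof (rule continuous[OF fin sub], intro allI impI)
    fix i assume "Suc i < length us"
    moreover have "us ! j = (f ^^ j) v0" if "j < length us" for j
      using that by (simp add: us_def del: upt_Suc)
    ultimately have "us ! i = (f ^^ i) v0" "us ! Suc i = f ((f ^^ i) v0)"
      by simp_all
    then show "\<exists>x \<in> nonmult_vars L (us ! i) U. inv_dvd L U (us ! Suc i) (add_mset x (us ! i))"
      using f[OF iter[of i]] by simp
  qed
  then have "length us \<le> card U"
    using card_mono[OF fin sub] by (simp add: distinct_card)
  then show False
    by (simp add: us_def)
qed

lemma involutive_set_if_no_irreducible:
  assumes "finite U" "\<not> (\<exists>u x. irreducible_prolongation L U u x)"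
  shows "involutive_set L U"
proof -
  have "add_mset y v \<in> inv_cone L U" if "v \<in> U" "y \<in> nonmult_vars L v U" for v y
    using assms(2) that unfolding irreducible_prolongation_def inv_cone_iff by blast
  then have "cone U \<subseteq> inv_cone L U"
    using inv_cone_if_prolongations_below[OF assms(1)] by blast
  moreover have "inv_cone L U \<subseteq> cone U"
    unfolding subset_iff inv_cone_iff cone_iff by (blast dest: inv_dvd_imp_subseteq_mset)
  ultimately show ?thesis
    unfolding involutive_set_def by blast
qed

end

section \<open>Steps and runs of the algorithm\<close>

context involutive_division
begin

lemma completion_step_psubset:
  assumes "finite V" "completion_step L V W"
  shows "V \<subset> W"
proof -
  obtain u x where ux: "irreducible_prolongation L V u x" "W = insert (add_mset x u) V"
    using assms(2) unfolding completion_step_def by blast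
  have "add_mset x u \<notin> V"
    using ux(1) inv_dvd_self[OF assms(1)] unfolding irreducible_prolongation_def by blast
  with ux(2) show ?thesis by blast
qed

lemma cone_completion_step:
  assumes "completion_step L V W"
  shows "cone W = cone V"
proof -
  obtain u x where ux: "u \<in> V" "W = insert (add_mset x u) V"
    using assms unfolding completion_step_def irreducible_prolongation_def by blast
  have "u \<subseteq># w" if "add_mset x u \<subseteq># w" for w
    using that subset_mset.order_trans[of u "add_mset x u" w] by simp
  then show ?thesis
    using ux(1) unfolding ux(2) set_eq_iff cone_iff by blast
qed

end

context constructive_division
begin

text \<open>
  Constructivity says that no element of the involutive cone, when added to the current set, becomes
  an involutive divisor of an irreducible prolongation with minimal product. The involutive divisor
  that \<open>V\<close> has for the new element would do just that, unless it is the new element itself: it lies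
  in \<open>C(U) = C(W)\<close>, and \<open>C(W)\<close> and \<open>C\<^sub>L(W)\<close> have the same proper divisors of the new element.
\<close>

lemma completion_step_subset_completion:
  assumes V: "is_completion L U V" and WV: "W \<subseteq> V" and cone_W: "cone W = cone U"
    and step: "completion_step L W W'"
  shows "W' \<subseteq> V"
proof -
  have finV: "finite V" and invol: "cone V = inv_cone L V" and cone_V: "cone V = cone U"
    using V unfolding is_completion_def involutive_set_def by auto
  have finW: "finite W"
    using finV WV by (rule finite_subset[rotated])
  obtain r u x where adm: "admissible_ordering r"
    and irr: "irreducible_prolongation L W u x"
    and low: "\<And>v y. irreducible_prolongation L W v y \<Longrightarrow> (add_mset x u, add_mset y v) \<in> r"
    and W': "W' = insert (add_mset x u) W"
    using step unfolding completion_step_def by blast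
  have anti: "antisym r"
    using adm unfolding admissible_ordering_def linear_order_on_def partial_order_on_def by blast
  have below: "add_mset y v \<in> inv_cone L W"
    if v: "v \<in> W" "y \<in> nonmult_vars L v W" "add_mset y v \<subseteq># add_mset x u"
      "add_mset y v \<noteq> add_mset x u" for v y
  proof (rule ccontr)
    assume "add_mset y v \<notin> inv_cone L W"
    then have "irreducible_prolongation L W v y"
      using v unfolding irreducible_prolongation_def inv_cone_iff by blast
    then have "(add_mset x u, add_mset y v) \<in> r"
      by (rule low)
    moreover have "(add_mset y v, add_mset x u) \<in> r"
      by (rule admissible_ordering_subseteq_mset[OF adm v(3)])
    ultimately show False
      using anti v(4) by (auto dest: antisymD)
  qed
  have "add_mset x u \<in> V"
  proof (rule ccontr)
    assume not_in: "add_mset x u \<notin> V"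
    have "u \<in> V"
      using irr WV unfolding irreducible_prolongation_def by blast
    then have "add_mset x u \<in> cone V"
      unfolding cone_iff by (intro bexI[of _ u]) auto
    then obtain w where w: "w \<in> V" "inv_dvd L V w (add_mset x u)"
      unfolding invol inv_cone_iff by blast
    have w_dvd: "w \<subseteq># add_mset x u" and w_ne: "w \<noteq> add_mset x u"
      using w not_in inv_dvd_imp_subseteq_mset by auto
    have "w \<in> cone W"
      using w(1) cone_V cone_W cone_iff by blast
    then have "w \<in> inv_cone L W"
    proof (rule inv_cone_if_prolongations_below[OF finW])
      fix v y assume v: "v \<in> W" "y \<in> nonmult_vars L v W" and dvd_w: "add_mset y v \<subseteq># w"
      have "add_mset y v \<subseteq># add_mset x u"
        using dvd_w w_dvd by (rule subset_mset.order_trans)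
      moreover have "add_mset y v \<noteq> add_mset x u"
        using dvd_w w_dvd w_ne by (auto dest: subset_mset.antisym)
      ultimately show "add_mset y v \<in> inv_cone L W"
        by (rule below[OF v])
    qed
    then have "add_mset x u \<notin> inv_multiples L w (insert w W)"
      using constructive[OF finW irr] below by blast
    moreover have "inv_dvd L (insert w W) w (add_mset x u)"
      by (rule inv_dvd_antimono[OF finV _ _ w(2)]) (use w(1) WV in auto)
    ultimately show False
      unfolding inv_dvd_def by blast
  qed
  with W' WV show ?thesis by blast
qed

lemma completion_run_invariant:
  assumes "completion_run L U R"
  shows "cone (R i) = cone U \<and> U \<subseteq> R i \<and> (\<forall>V. is_completion L U V \<longrightarrow> R i \<subseteq> V)"
proof (induction i)
  case 0
  then show ?case
    using assms by (auto simp: completion_run_def is_completion_def)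
next
  case (Suc i)
  show ?case
  proof (cases "\<exists>u x. irreducible_prolongation L (R i) u x")
    case True
    then have step: "completion_step L (R i) (R (Suc i))"
      using assms unfolding completion_run_def by simp
    have "cone (R (Suc i)) = cone U"
      using cone_completion_step[OF step] Suc by simp
    moreover have "U \<subseteq> R (Suc i)"
      using step Suc unfolding completion_step_def by blast
    moreover have "R (Suc i) \<subseteq> V" if "is_completion L U V" for V
      using completion_step_subset_completion[OF that _ _ step] Suc that by simp
    ultimately show ?thesis by simp
  next
    case False
    then have "R (Suc i) = R i"
      using assms unfolding completion_run_def by simp
    with Suc show ?thesis by simp
  qed
qed

lemma completion_run_ends:
  assumes run: "completion_run L U R" and V: "is_completion L U V"
  obtains n where "\<not> (\<exists>u x. irreducible_prolongation L (R n) u x)"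
proof (rule ccontr)
  assume "\<not> thesis"
  then have "\<exists>u x. irreducible_prolongation L (R i) u x" for i
    using that by blast
  then have step: "completion_step L (R i) (R (Suc i))" for i
    using run unfolding completion_run_def by simp
  have finV: "finite V"
    using V unfolding is_completion_def by blast
  have sub: "R i \<subseteq> V" for i
    using completion_run_invariant[OF run] V by blast
  then have fin: "finite (R i)" for i
    using finV finite_subset by blast
  have "i \<le> card (R i)" for i
  proof (induction i)
    case (Suc i)
    then show ?case
      using psubset_card_mono[OF fin completion_step_psubset[OF fin step[of i]]] by linarith
  qed simp
  from this[of "Suc (card V)"] card_mono[OF finV sub[of "Suc (card V)"]] show False
    by linarith
qed

lemma completion_run_least_completion:
  assumes run: "completion_run L U R" and fg: "finitely_generated L U"
  obtains F where "is_completion L U F" "\<forall>V. is_completion L U V \<longrightarrow> F \<subseteq> V"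
    "checked_prolongations L R = {(u, x). u \<in> F \<and> x \<in> nonmult_vars L u F}"
proof -
  obtain V where V: "is_completion L U V"
    using fg unfolding finitely_generated_def by blast
  obtain n where n: "\<not> (\<exists>u x. irreducible_prolongation L (R n) u x)"
    using completion_run_ends[OF run V] .
  note inv = completion_run_invariant[OF run]
  have fin: "finite (R n)"
    using inv[of n] V finite_subset[of "R n" V] unfolding is_completion_def by blast
  have compl: "is_completion L U (R n)"
    using inv[of n] fin involutive_set_if_no_irreducible[OF fin n]
    unfolding is_completion_def by blast
  \<comment> \<open>For every stage, also those before \<open>n\<close>: all stages lie in the completion \<open>R n\<close>.\<close>
  have sub: "R i \<subseteq> R n" for i
    using inv[of i] compl by blast
  show thesis
  proof (rule that[OF compl])
    show "\<forall>V. is_completion L U V \<longrightarrow> R n \<subseteq> V"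
      using inv[of n] by blast
    show "checked_prolongations L R = {(u, x). u \<in> R n \<and> x \<in> nonmult_vars L u (R n)}"
    proof (intro subset_antisym subsetI)
      fix p assume "p \<in> checked_prolongations L R"
      then obtain u x i where p: "p = (u, x)" "u \<in> R i" "x \<in> nonmult_vars L u (R i)"
        unfolding checked_prolongations_def by auto
      then show "p \<in> {(u, x). u \<in> R n \<and> x \<in> nonmult_vars L u (R n)}"
        using sub[of i] nonmult_vars_mono[OF fin sub p(2)] by auto
    qed (auto simp: checked_prolongations_def)
  qed
qed

end

theorem theorem4p3:
  fixes L :: "('x::finite) division"
    and U :: "'x monomial set"
    and R R' :: "nat \<Rightarrow> 'x monomial set"
  assumes "constructive_division L"
    and "finite U"
    and "finitely_generated L U"
    and "completion_run L U R"
    and "completion_run L U R'"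
  shows "finite (checked_prolongations L R) \<and>
         finite (checked_prolongations L R') \<and>
         card (checked_prolongations L R) = card (checked_prolongations L R')"
proof -
  interpret constructive_division L by fact
  obtain F where F: "is_completion L U F" "\<forall>V. is_completion L U V \<longrightarrow> F \<subseteq> V"
    "checked_prolongations L R = {(u, x). u \<in> F \<and> x \<in> nonmult_vars L u F}"
    using completion_run_least_completion[OF assms(4,3)] .
  obtain F' where F': "is_completion L U F'" "\<forall>V. is_completion L U V \<longrightarrow> F' \<subseteq> V"
    "checked_prolongations L R' = {(u, x). u \<in> F' \<and> x \<in> nonmult_vars L u F'}"
    using completion_run_least_completion[OF assms(5,3)] .
  have "F = F'"
    using F F' by blast
  moreover have "finite (checked_prolongations L R)"
  proof (rule finite_subset)
    show "checked_prolongations L R \<subseteq> F \<times> UNIV"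
      using F(3) by auto
    show "finite (F \<times> (UNIV :: 'x set))"
      using F(1) unfolding is_completion_def by simp
  qed
  ultimately show ?thesis
    using F(3) F'(3) by simp
qed

end
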